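(* Let $f$ be a $g$-convex function on the interval $J$. Then $f$ is convex and $$f\left(\sum_{i=1}^{n} w_i x_i\right)\le g^{-1}\left(\sum_{i=1}^{n} w_i\,(g\circ f)(x_i)\right)\le \sum_{i=1}^{n} w_i f(x_i)$$ for every $n\in\mathbb{N}$, any $x_1,\ldots,x_n\in J$ and any $0\le w_1,\ldots,w_n\le 1$ with $\sum_{i=1}^{n} w_i=1$.
   Context: Let $J,J_2,J_3\subseteq\mathbb{R}$ be intervals. A continuous function $f:J\to J_2$ is called $g$-convex on $J$ if $g:J_2\to J_3$ is (strictly) increasing and concave on $J_2$ and $g\circ f:J\to J_3$ is convex. $g^{-1}$ denotes the inverse of $g$, defined on $g(J_2)$. *)

theory Defs
  imports "HOL-Analysis.Analysis"
begin

text \<open>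
  Here \<open>f : J \<rightarrow> J2\<close> and \<open>g : J2 \<rightarrow> J3\<close> are represented by total functions that are constrained
  on their domains only; \<open>J\<close>, \<open>J2\<close>, \<open>J3\<close> are meant to be intervals (\<open>is_interval\<close>, so any of
  open, closed, half-open, bounded, unbounded or degenerate).  Increasing is read strictly, so
  that \<open>g\<close> has an inverse on \<open>g ` J2\<close>, which is \<open>the_inv_into J2 g\<close>.
\<close>

definition g_convex_on ::
  "real set \<Rightarrow> real set \<Rightarrow> real set \<Rightarrow> (real \<Rightarrow> real) \<Rightarrow> (real \<Rightarrow> real) \<Rightarrow> bool"
  where
  "g_convex_on J J2 J3 g f \<longleftrightarrow>
     continuous_on J f \<and> f \<in> J \<rightarrow> J2 \<and>
     g \<in> J2 \<rightarrow> J3 \<and> strict_mono_on J2 g \<and> concave_on J2 g \<and>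
     convex_on J (g \<circ> f)"

end

theory Submission
  imports Defs
begin

text \<open>
  Both inequalities are Jensen's inequality, for the convex \<open>g \<circ> f\<close> and the concave \<open>g\<close>, pulled
  back through the strictly increasing \<open>g\<close>.  The delicate point is that the weighted mean of the
  values of \<open>g \<circ> f\<close> lies in the image of \<open>g\<close>: a concave \<open>g\<close> may jump at the left endpoint of
  \<open>J2\<close>.  But \<open>(g \<circ> f) ` J\<close> is an interval all the same, because convexity of \<open>g \<circ> f\<close>
  makes it continuous inside a segment and keeps it small near the end with the smaller value,
  while concavity of \<open>g\<close> and continuity of \<open>f\<close> keep it large near the other end.
\<close>

text \<open>Strict monotonicity moves a bound on the inverse to a bound on \<open>g\<close>, where
  Jensen's inequality applies; this requires knowing first that \<open>s\<close> is a value of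
  \<open>g\<close>.\<close>

lemma strict_mono_on_the_inv_into_le_iff:
  fixes g :: "'a::linorder \<Rightarrow> 'b::linorder"
  assumes "strict_mono_on A g" "s \<in> g ` A" "z \<in> A"
  shows "the_inv_into A g s \<le> z \<longleftrightarrow> s \<le> g z" "z \<le> the_inv_into A g s \<longleftrightarrow> g z \<le> s"
proof -
  obtain y where "y \<in> A" "s = g y"
    using assms(2) by blast
  moreover have "the_inv_into A g (g y) = y"
    using \<open>y \<in> A\<close> assms(1) by (simp add: strict_mono_on_imp_inj_on the_inv_into_f_f)
  ultimately show "the_inv_into A g s \<le> z \<longleftrightarrow> s \<le> g z" "z \<le> the_inv_into A g s \<longleftrightarrow> g z \<le> s"
    using assms(1,3) by (simp_all add: strict_mono_on_less_eq)
qed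

text \<open>The bounds from convexity of \<open>g \<circ> f\<close> and concavity of
  \<open>g\<close> meet at the same chord value; then \<open>g\<close> cancels, since it reflects
  the order.\<close>

lemma g_convex_on_imp_convex_on:
  assumes J: "is_interval J" and J2: "is_interval J2" and gc: "g_convex_on J J2 J3 g f"
  shows "convex_on J f"
proof (rule convex_onI)
  note gc = gc[unfolded g_convex_on_def]
  show "convex J"
    using J by (simp add: is_interval_convex)
  fix t x y :: real
  assume t: "0 < t" "t < 1" and xy: "x \<in> J" "y \<in> J"
  have f: "f x \<in> J2" "f y \<in> J2" "f ((1 - t) *\<^sub>R x + t *\<^sub>R y) \<in> J2"
    using gc xy convexD_alt[OF \<open>convex J\<close> xy, of t] t by auto
  have m: "(1 - t) * f x + t * f y \<in> J2"
    using convexD_alt[OF is_interval_convex[OF J2], of "f x" "f y" t] f t by simp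
  have "g (f ((1 - t) *\<^sub>R x + t *\<^sub>R y)) \<le> (1 - t) * g (f x) + t * g (f y)"
    using convex_onD[of J "g \<circ> f" t x y] gc xy t by simp
  also have "\<dots> \<le> g ((1 - t) * f x + t * f y)"
    using concave_onD[of J2 g t "f x" "f y"] gc f t by simp
  finally show "f ((1 - t) *\<^sub>R x + t *\<^sub>R y) \<le> (1 - t) * f x + t * f y"
    using strict_mono_on_less_eq[of J2 g, OF _ f(3) m] gc by simp
qed

text \<open>It suffices to bracket \<open>s\<close> by values at two interior points:
  \<open>u\<close> from convexity of \<open>g \<circ> f\<close>, and \<open>r\<close> from concavity
  of \<open>g\<close> and continuity of \<open>f\<close>.\<close>

lemma g_convex_on_intermediate_value:
  assumes J: "is_interval J" and gc: "g_convex_on J J2 J3 g f"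
    and pq: "p \<in> J" "q \<in> J" and s: "g (f p) < s" "s < g (f q)"
  shows "s \<in> (g \<circ> f) ` J"
proof -
  define d where "d = g (f q) - g (f p)"
  have "d > 0"
    using s by (simp add: d_def)
  note gc = gc[unfolded g_convex_on_def]
  have fJ: "f p \<in> J2" "f q \<in> J2"
    using gc pq by auto
  have lt: "f p < f q"
    using fJ s gc strict_mono_on_less[of J2 g "f p" "f q"] by simp
  have "p \<noteq> q"
    using s by auto
  have seg: "closed_segment p q \<subseteq> J"
    using pq J by (simp add: closed_segment_subset is_interval_convex)
  have oseg: "open_segment p q \<subseteq> J"
    using seg segment_open_subset_closed by blast
  \<comment> \<open>A convex function may jump at an endpoint of its domain, so only the open
    segment is used.\<close>
  have cont: "continuous_on (open_segment p q) (g \<circ> f)"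
  proof (rule convex_on_continuous)
    show "open (open_segment p q)"
      by (simp add: open_segment_eq_real_ivl)
    show "convex_on (open_segment p q) (g \<circ> f)"
      using gc oseg convex_on_subset convex_open_segment by blast
  qed
  \<comment> \<open>At \<open>u\<close> the chord of \<open>g \<circ> f\<close> from \<open>p\<close> to \<open>q\<close> takes the value \<open>s\<close>.\<close>
  define t where "t = (s - g (f p)) / d"
  have t: "0 < t" "t < 1"
    using s by (auto simp: t_def d_def)
  define u where "u = (1 - t) *\<^sub>R p + t *\<^sub>R q"
  have u: "u \<in> open_segment p q"
    using t \<open>p \<noteq> q\<close> by (auto simp: u_def in_segment)
  have "(g \<circ> f) u \<le> (1 - t) * g (f p) + t * g (f q)"
    using convex_onD[of J "g \<circ> f" t p q] gc pq t by (simp add: u_def)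
  also have "\<dots> = g (f p) + t * d"
    by (simp add: d_def algebra_simps)
  also have "\<dots> = s"
    using \<open>d > 0\<close> by (simp add: t_def)
  finally have gu: "(g \<circ> f) u \<le> s" .
  \<comment> \<open>At \<open>y\<close> the chord of \<open>g\<close> from \<open>f p\<close> to \<open>f q\<close> takes the value \<open>s\<close>.\<close>
  define y where "y = (1 - t) * f p + t * f q"
  have y: "f p < y" "y < f q"
  proof -
    have "y = f p + t * (f q - f p)" "f q = y + (1 - t) * (f q - f p)"
      by (simp_all add: y_def algebra_simps)
    moreover have "0 < t * (f q - f p)" "0 < (1 - t) * (f q - f p)"
      using t lt by simp_all
    ultimately show "f p < y" "y < f q"
      by linarith+
  qed
  have "s = g (f p) + t * d"
    using \<open>d > 0\<close> by (simp add: t_def)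
  also have "\<dots> = (1 - t) * g (f p) + t * g (f q)"
    by (simp add: d_def algebra_simps)
  also have "\<dots> \<le> g y"
    using concave_onD[of J2 g t "f p" "f q"] gc fJ t by (simp add: y_def)
  finally have gy: "s \<le> g y" .
  have "connected (f ` closed_segment p q)"
    using gc seg by (intro connected_continuous_image) (auto intro: continuous_on_subset)
  then have "y \<in> f ` closed_segment p q"
    using y by (elim connectedD_interval[of _ "f p" "f q"]) auto
  then obtain r where r: "r \<in> closed_segment p q" "f r = y"
    by blast
  \<comment> \<open>\<open>r\<close> is not an endpoint because \<open>y\<close> lies strictly
    between \<open>f p\<close> and \<open>f q\<close>.\<close>
  have "r \<in> open_segment p q"
    using r y by (auto simp: open_segment_def)
  moreover have "connected ((g \<circ> f) ` open_segment p q)"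
    using cont by (intro connected_continuous_image) (auto intro: convex_connected)
  ultimately have "s \<in> (g \<circ> f) ` open_segment p q"
    using u gu gy r
      connectedD_interval[of "(g \<circ> f) ` open_segment p q" "(g \<circ> f) u" "(g \<circ> f) r" s]
    by auto
  then show ?thesis
    using oseg by blast
qed

lemma g_convex_on_is_interval_image:
  assumes "is_interval J" and "g_convex_on J J2 J3 g f"
  shows "is_interval ((g \<circ> f) ` J)"
  unfolding is_interval_1
proof (intro ballI allI impI)
  fix a b s
  assume ab: "a \<in> (g \<circ> f) ` J" "b \<in> (g \<circ> f) ` J" and s: "a \<le> s \<and> s \<le> b"
  then obtain p q where pq: "p \<in> J" "a = g (f p)" "q \<in> J" "b = g (f q)"
    by auto
  show "s \<in> (g \<circ> f) ` J"
  proof (cases "s = a \<or> s = b")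
    case False
    then show ?thesis
      using g_convex_on_intermediate_value[OF assms] pq s by (simp add: order_less_le)
  qed (use ab in blast)
qed

theorem proposition2p1:
  fixes J J2 J3 :: "real set" and f g :: "real \<Rightarrow> real"
  assumes "is_interval J" and "is_interval J2" and "is_interval J3"
    and "g_convex_on J J2 J3 g f"
  shows "convex_on J f \<and>
    (\<forall>(n::nat) (x :: nat \<Rightarrow> real) (w :: nat \<Rightarrow> real).
      (\<forall>i\<in>{1..n}. x i \<in> J) \<longrightarrow> (\<forall>i\<in>{1..n}. 0 \<le> w i \<and> w i \<le> 1) \<longrightarrow> (\<Sum>i=1..n. w i) = 1 \<longrightarrow>
        (\<Sum>i=1..n. w i * (g \<circ> f) (x i)) \<in> g ` J2 \<and>
        f (\<Sum>i=1..n. w i * x i) \<le> the_inv_into J2 g (\<Sum>i=1..n. w i * (g \<circ> f) (x i)) \<and>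
        the_inv_into J2 g (\<Sum>i=1..n. w i * (g \<circ> f) (x i)) \<le> (\<Sum>i=1..n. w i * f (x i)))"
proof (intro conjI allI impI)
  show "convex_on J f"
    using assms g_convex_on_imp_convex_on by blast
next
  fix n :: nat and x w :: "nat \<Rightarrow> real"
  assume x: "\<forall>i\<in>{1..n}. x i \<in> J" and w: "\<forall>i\<in>{1..n}. 0 \<le> w i \<and> w i \<le> 1"
    and w1: "(\<Sum>i=1..n. w i) = 1"
  note gc = assms(4)[unfolded g_convex_on_def]
  have ne: "{1..n} \<noteq> {}"
    using w1 by (metis sum.empty zero_neq_one)
  \<comment> \<open>Needed for three intervals: \<open>J\<close>, \<open>J2\<close> and the image of
    \<open>J\<close> under \<open>g \<circ> f\<close>.\<close>
  have mean: "(\<Sum>i=1..n. w i * z i) \<in> A"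
    if "is_interval A" "\<forall>i\<in>{1..n}. z i \<in> A" for A and z :: "nat \<Rightarrow> real"
    using convex_sum[of "{1..n}" A w z] is_interval_convex[OF that(1)] that(2) w w1 by simp
  have fx: "\<forall>i\<in>{1..n}. f (x i) \<in> J2"
    using x gc by auto
  let ?s = "\<Sum>i=1..n. w i * (g \<circ> f) (x i)"
  \<comment> \<open>The detour through this smaller set is essential: the image of \<open>J2\<close>
    under \<open>g\<close> may have a gap, while this one is an interval.\<close>
  have "?s \<in> (g \<circ> f) ` J"
    using x by (intro mean g_convex_on_is_interval_image[OF assms(1,4)]) auto
  then show s: "?s \<in> g ` J2"
    using gc by auto
  have "f (\<Sum>i=1..n. w i * x i) \<in> J2"
    using gc mean[OF assms(1) x] by auto
  moreover have "g (f (\<Sum>i=1..n. w i * x i)) \<le> ?s"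
    using convex_on_sum[of "{1..n}" J "g \<circ> f" w x] gc x w w1 ne by simp
  ultimately show "f (\<Sum>i=1..n. w i * x i) \<le> the_inv_into J2 g ?s"
    using strict_mono_on_the_inv_into_le_iff(2)[of J2 g, OF _ s] gc by simp
  have "?s \<le> g (\<Sum>i=1..n. w i * f (x i))"
    using concave_on_sum[of "{1..n}" J2 g w "\<lambda>i. f (x i)"] gc fx w w1 ne by simp
  then show "the_inv_into J2 g ?s \<le> (\<Sum>i=1..n. w i * f (x i))"
    using strict_mono_on_the_inv_into_le_iff(1)[of J2 g, OF _ s mean[OF assms(2) fx]] gc by simp
qed

end
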